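(* Let $m \geq \ell \geq 2$ and $n \geq 0$, let $B \subseteq m^n$ be a set of leaves, and let $\ddot B$ be its $\ell$-ary normalization, defined as in the context with respect to any enumeration $(a_i : i < N)$ of $m^{<n}$ in which longer sequences come first. Then \[ \mathrm{MTD}_\ell(B) = \|\ddot B\|_\ell. \]
   Context: Nodes are sequences of length at most $n$ with entries in $\{0,\dots,m-1\}$ (the set $m^{\leq n}$), and $m^{<n}$ denotes those of length less than $n$. Leaves are elements of $m^n$. Write $a \prec b$ if $a$ is a proper initial segment of $b$, and let $a \wedge b$ be the longest common initial segment of $a$ and $b$. For $B \subseteq m^n$, $\check B$ is the set of all initial segments, including the sequences themselves, of elements of $B$. The meeted $\ell$-ary tree of height $d$ is $\hat T_{d,\ell} = (\ell^{\leq d}, \prec, \wedge)$. An embedding $f$ of $(A,\prec,\wedge)$ into $(A',\prec,\wedge)$ is an injective map such that for all $a,a'$: $a \prec a'$ iff $f(a) \prec f(a')$, and $f(a\wedge a') = f(a) \wedge f(a')$. For nonempty $B \subseteq m^n$, the meeted $\ell$-ary tree dimension $\mathrm{MTD}_\ell(B)$ is the largest nonnegative integer $d$ such that $\hat T_{d,\ell}$ embeds in $(\check B, \prec, \wedge)$. Set $\mathrm{MTD}_\ell(\emptyset) = -1$. $\ell$-ary norm: for a node $a$, $\|a\|_\ell$ is the number of indices $i < |a|$ with $a(i) \geq \ell - 1$. For a nonempty set of nodes $A$, $\|A\|_\ell = \max_{a\in A}\|a\|_\ell$, and $\|\emptyset\|_\ell = -1$. For a node $a$ and a set of nodes $A$,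 $A{\restriction}_a$ is the set of elements of $A$ having $a$ as an initial segment. Swaps: for $a \in m^{<n}$ and $k < m-1$, $\sigma_{a,k}$ is the map on $m^{\leq n}$ with $a^\frown k^\frown b \mapsto a^\frown (k+1)^\frown b$ and $a^\frown (k+1)^\frown b \mapsto a^\frown k^\frown b$ for every sequence $b$ of length at most $n-|a|-1$. It fixes all other nodes. $\ell$-ary normalization: let $N = m^{n-1} + \cdots + m^0$, and let $(a_i : i < N)$ enumerate $m^{<n}$ so that $|a_i| > |a_j|$ implies $i<j$. Put $B_0 = B$. For each $i < N$ in turn: - Set $B_{i,0} = B_i$. - For each $j < m-1$ in turn, set $B_{i,j,0} = B_{i,j}$, and then for each $k < m-j-1$ in turn: - if $\|B_{i,j,k}{\restriction}_{a_i^\frown k}\|_\ell - \|a_i^\frown k\|_\ell \geq \|B_{i,j,k}{\restriction}_{a_i^\frown (k+1)}\|_\ell - \|a_i^\frown (k+1)\|_\ell$, let $B_{i,j,k+1} = B_{i,j,k}$; - otherwise let $B_{i,j,k+1} = \sigma_{a_i,k}(B_{i,j,k})$. - After the $k$-loop, let $B_{i,j+1} = B_{i,j,m-j-1}$. - After the $j$-loop, let $B_{i+1} = B_{i,m-1}$. Finally $\ddot B = B_N$. *)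

theory Defs
  imports Main "HOL-Library.Sublist"
begin

type_synonym node = "nat list"

definition nodes :: "nat \<Rightarrow> nat \<Rightarrow> node set" where
  "nodes m n = {a. length a \<le> n \<and> set a \<subseteq> {..<m}}"

definition inner_nodes :: "nat \<Rightarrow> nat \<Rightarrow> node set" where
  "inner_nodes m n = {a. length a < n \<and> set a \<subseteq> {..<m}}"

definition leaves :: "nat \<Rightarrow> nat \<Rightarrow> node set" where
  "leaves m n = {a. length a = n \<and> set a \<subseteq> {..<m}}"

definition initial_closure :: "node set \<Rightarrow> node set" where
  "initial_closure B = {a. \<exists>b\<in>B. prefix a b}"

text \<open>Embeddings of sets of sequences with the proper initial segment order and the binary meet
  (longest common initial segment). The sets to which this is applied are closed under meets.\<close>

definition meet_embedding :: "(node \<Rightarrow> node) \<Rightarrow> node set \<Rightarrow> node set \<Rightarrow> bool" where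
  "meet_embedding f A A' \<longleftrightarrow>
     f ` A \<subseteq> A' \<and> inj_on f A \<and>
     (\<forall>a\<in>A. \<forall>a'\<in>A. strict_prefix a a' \<longleftrightarrow> strict_prefix (f a) (f a')) \<and>
     (\<forall>a\<in>A. \<forall>a'\<in>A. f (longest_common_prefix a a') = longest_common_prefix (f a) (f a'))"

text \<open>For nonempty \<open>B\<close> consisting of sequences of length at most \<open>n\<close>, the greatest element
  below exists: \<open>d = 0\<close> is admissible, and any admissible \<open>d\<close> is at most \<open>n\<close>, since a chain with
  \<open>d + 1\<close> elements embeds.\<close>

definition MTD :: "nat \<Rightarrow> node set \<Rightarrow> int" where
  "MTD l B =
     (if B = {} then - 1
      else int (GREATEST d. \<exists>f. meet_embedding f (nodes l d) (initial_closure B)))"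

definition node_norm :: "nat \<Rightarrow> node \<Rightarrow> nat" where
  "node_norm l a = card {i. i < length a \<and> a ! i \<ge> l - 1}"

definition set_norm :: "nat \<Rightarrow> node set \<Rightarrow> int" where
  "set_norm l A = (if A = {} then - 1 else int (Max (node_norm l ` A)))"

definition restrict_above :: "node set \<Rightarrow> node \<Rightarrow> node set" where
  "restrict_above A a = {x\<in>A. prefix a x}"

definition swap :: "node \<Rightarrow> nat \<Rightarrow> node \<Rightarrow> node" where
  "swap a k x =
     (if prefix (a @ [k]) x then a @ [Suc k] @ drop (Suc (length a)) x
      else if prefix (a @ [Suc k]) x then a @ [k] @ drop (Suc (length a)) x
      else x)"

definition compare_step :: "nat \<Rightarrow> node \<Rightarrow> nat \<Rightarrow> node set \<Rightarrow> node set" where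
  "compare_step l a k C =
     (if set_norm l (restrict_above C (a @ [k])) - int (node_norm l (a @ [k]))
         \<ge> set_norm l (restrict_above C (a @ [Suc k])) - int (node_norm l (a @ [Suc k]))
      then C else swap a k ` C)"

definition sort_pass :: "nat \<Rightarrow> nat \<Rightarrow> node \<Rightarrow> nat \<Rightarrow> node set \<Rightarrow> node set" where
  "sort_pass l m a j C = fold (compare_step l a) [0..<m - j - 1] C"

definition sort_at :: "nat \<Rightarrow> nat \<Rightarrow> node \<Rightarrow> node set \<Rightarrow> node set" where
  "sort_at l m a C = fold (sort_pass l m a) [0..<m - 1] C"

definition num_inner_nodes :: "nat \<Rightarrow> nat \<Rightarrow> nat" where
  "num_inner_nodes m n = (\<Sum>i<n. m ^ i)"

definition longest_first_enumeration :: "nat \<Rightarrow> nat \<Rightarrow> (nat \<Rightarrow> node) \<Rightarrow> bool" where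
  "longest_first_enumeration m n a \<longleftrightarrow>
     bij_betw a {..<num_inner_nodes m n} (inner_nodes m n) \<and>
     (\<forall>i<num_inner_nodes m n. \<forall>j<num_inner_nodes m n. length (a i) > length (a j) \<longrightarrow> i < j)"

definition normalization :: "nat \<Rightarrow> nat \<Rightarrow> nat \<Rightarrow> (nat \<Rightarrow> node) \<Rightarrow> node set \<Rightarrow> node set" where
  "normalization l m n a B = fold (\<lambda>i. sort_at l m (a i)) [0..<num_inner_nodes m n] B"

end

(* Swaps are injective and preserve meets, so the normalization C of B has the same dimension as
   B. At every node of C the norms of the child subtrees are non-increasing, since the loop at a
   node is a bubble sort that does not disturb the order already established elsewhere. In any
   set, an embedded tree of depth d yields a leaf of norm at least d: among the l directions
   leaving the image of the root one is at least l - 1. Conversely, if the child norms are non-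
   increasing, a leaf of norm d + 1 passes a direction k \<ge> l - 1 with norm at least d above
   it, so the directions 0, ..., l - 1 all have subtrees of norm at least d, and embeddings into
   these assemble to one of depth d + 1. *)
theory Submission
  imports Defs
begin

section \<open>Subtrees above a node and their emptiness\<close>

text \<open>The prefix \<open>p\<close> is removed, so that the relative norms compared by the
  algorithm become plain norms and inductions can pass to a subtree.\<close>

definition subtree :: "node set \<Rightarrow> node \<Rightarrow> node set" where
  "subtree C p = {x. p @ x \<in> C}"

text \<open>Empty subtrees have norm -1, so the condition puts empty children last. The index can
  stay unbounded: for leaves over \<open>m\<close>, the children from \<open>m\<close> on are
  empty.\<close>

definition ordered_at :: "nat \<Rightarrow> node set \<Rightarrow> node \<Rightarrow> bool" where
  "ordered_at l C p \<longleftrightarrow>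
     (\<forall>k. set_norm l (subtree C (p @ [Suc k])) \<le> set_norm l (subtree C (p @ [k])))"

lemma mem_subtree [simp]: "x \<in> subtree C p \<longleftrightarrow> p @ x \<in> C"
  by (simp add: subtree_def)

lemma subtree_subtree [simp]: "subtree (subtree C p) q = subtree C (p @ q)"
  by (auto simp: subtree_def)

lemma finite_subtree:
  assumes "finite C"
  shows "finite (subtree C p)"
proof -
  have "(@) p ` subtree C p \<subseteq> C" by auto
  then have "finite ((@) p ` subtree C p)" using assms finite_subset by blast
  then show ?thesis by (rule finite_imageD) (simp add: inj_on_def)
qed

lemma restrict_above_eq: "restrict_above C p = (@) p ` subtree C p"
  by (auto simp: restrict_above_def prefix_def)

lemma initial_closureI: "x @ y \<in> C \<Longrightarrow> x \<in> initial_closure C"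
  by (auto simp: initial_closure_def prefix_def)

lemma initial_closure_iff: "x \<in> initial_closure C \<longleftrightarrow> (\<exists>y. x @ y \<in> C)"
  by (auto simp: initial_closure_def prefix_def)

lemma initial_closure_subtree: "x \<in> initial_closure (subtree C p) \<longleftrightarrow> p @ x \<in> initial_closure C"
  by (simp add: initial_closure_iff)

lemma finite_leaves: "finite (leaves m n)"
  unfolding leaves_def using finite_lists_length_eq[of "{..<m}" n] by (simp add: conj_commute)

lemma subtree_empty_of_not_inner:
  assumes "C \<subseteq> leaves m n" and "p \<notin> inner_nodes m n"
  shows "subtree C (p @ [k]) = {}"
  using assms by (fastforce simp: leaves_def inner_nodes_def subtree_def)

lemma subtree_empty_of_ge:
  assumes "C \<subseteq> leaves m n" and "m \<le> k"
  shows "subtree C (p @ [k]) = {}"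
  using assms by (fastforce simp: leaves_def subtree_def)

subsection \<open>Norms\<close>

lemma node_norm_eq_length_filter: "node_norm l x = length (filter (\<lambda>c. l - 1 \<le> c) x)"
  by (simp add: node_norm_def length_filter_conv_card)

lemma node_norm_append [simp]: "node_norm l (x @ y) = node_norm l x + node_norm l y"
  by (simp add: node_norm_eq_length_filter)

lemma node_norm_Cons: "node_norm l (c # x) = (if l - 1 \<le> c then 1 else 0) + node_norm l x"
  by (simp add: node_norm_eq_length_filter)

text \<open>Cut at the first entry that is at least \<open>l - 1\<close>: nothing before it counts,
  so the rest \<open>y\<close> loses only one from the norm.\<close>

lemma node_norm_split:
  assumes "Suc d \<le> node_norm l x"
  obtains b k y where "x = b @ k # y" "l - 1 \<le> k" "d \<le> node_norm l y"
  using assms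
proof (induction x arbitrary: thesis)
  case Nil
  then show ?case by (simp add: node_norm_eq_length_filter)
next
  case (Cons c x)
  show ?case
  proof (cases "l - 1 \<le> c")
    case True
    then show ?thesis using Cons.prems(1)[of "[]" c x] Cons.prems(2) by (simp add: node_norm_Cons)
  next
    case False
    then have "Suc d \<le> node_norm l x" using Cons.prems(2) by (simp add: node_norm_Cons)
    then obtain b k y where "x = b @ k # y" "l - 1 \<le> k" "d \<le> node_norm l y"
      using Cons.IH by blast
    then show ?thesis using Cons.prems(1)[of "c # b" k y] by simp
  qed
qed

lemma set_norm_empty [simp]: "set_norm l {} = - 1"
  by (simp add: set_norm_def)

lemma set_norm_ge: "- 1 \<le> set_norm l A"
  by (simp add: set_norm_def)

lemma set_norm_nonneg: "A \<noteq> {} \<Longrightarrow> 0 \<le> set_norm l A"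
  by (simp add: set_norm_def)

lemma le_set_norm_iff:
  assumes "finite A"
  shows "int d \<le> set_norm l A \<longleftrightarrow> (\<exists>x\<in>A. d \<le> node_norm l x)"
  using assms by (auto simp: set_norm_def Max_ge_iff)

text \<open>Prepending \<open>p\<close> shifts every norm, hence the maximum, by the norm of
  \<open>p\<close>. The value -1 of the empty set is a convention and does not shift, which leaves
  the odd first case.\<close>

lemma set_norm_restrict_above:
  assumes "finite C"
  shows "set_norm l (restrict_above C p) - int (node_norm l p) =
    (if subtree C p = {} then - 1 - int (node_norm l p) else set_norm l (subtree C p))"
proof (cases "subtree C p = {}")
  case False
  have "Max (node_norm l ` restrict_above C p)
      = Max ((\<lambda>x. node_norm l x + node_norm l p) ` subtree C p)"
    by (simp add: restrict_above_eq image_image add.commute)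
  also have "\<dots> = Max (node_norm l ` subtree C p) + node_norm l p"
    using False finite_subtree[OF assms] by (intro Max_add_commute) auto
  finally show ?thesis using False by (simp add: set_norm_def restrict_above_eq)
qed (simp add: restrict_above_eq)

subsection \<open>Embedded trees and norms\<close>

lemma prefix_iff_lcp: "prefix x y \<longleftrightarrow> longest_common_prefix x y = x"
  by (induction x y rule: longest_common_prefix.induct) auto

lemma lcp_append_same [simp]:
  "longest_common_prefix (p @ x) (p @ y) = p @ longest_common_prefix x y"
  by (induction p) auto

lemma prefix_closed_nodes: "y \<in> nodes m n \<Longrightarrow> prefix x y \<Longrightarrow> x \<in> nodes m n"
  by (auto simp: nodes_def prefix_def)

lemma lcp_in_nodes: "x \<in> nodes m n \<Longrightarrow> longest_common_prefix x y \<in> nodes m n"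
  using longest_common_prefix_prefix1 prefix_closed_nodes by blast

text \<open>The order condition comes for free: \<open>x\<close> is a prefix of \<open>y\<close> iff
  their meet is \<open>x\<close>, an equation that \<open>f\<close> preserves and, being injective
  on the meet-closed set of nodes, reflects.\<close>

lemma meet_embeddingI:
  assumes "\<And>x. x \<in> nodes m n \<Longrightarrow> f x \<in> A" and inj: "inj_on f (nodes m n)"
    and lcp: "\<And>x y. x \<in> nodes m n \<Longrightarrow> y \<in> nodes m n \<Longrightarrow>
      f (longest_common_prefix x y) = longest_common_prefix (f x) (f y)"
  shows "meet_embedding f (nodes m n) A"
proof -
  have "strict_prefix x y \<longleftrightarrow> strict_prefix (f x) (f y)"
    if x: "x \<in> nodes m n" and y: "y \<in> nodes m n" for x y
  proof -
    have "prefix (f x) (f y) \<longleftrightarrow> f (longest_common_prefix x y) = f x"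
      using lcp[OF x y] by (simp add: prefix_iff_lcp)
    also have "\<dots> \<longleftrightarrow> prefix x y"
      using inj_on_eq_iff[OF inj lcp_in_nodes[OF x] x] by (simp add: prefix_iff_lcp)
    finally show ?thesis
      using inj_on_eq_iff[OF inj x y] by (auto simp: strict_prefix_def)
  qed
  then show ?thesis using assms by (auto simp: meet_embedding_def)
qed

lemma meet_embedding_imp_norm:
  assumes "meet_embedding f (nodes l d) (initial_closure C)" and "1 \<le> l"
  shows "\<exists>x\<in>C. d \<le> node_norm l x"
  using assms(1)
proof (induction d arbitrary: f C)
  case 0
  have "[] \<in> nodes l 0" by (simp add: nodes_def)
  then have "f [] \<in> initial_closure C" using 0 by (auto simp: meet_embedding_def)
  then show ?case by (auto simp: initial_closure_def)
next
  case (Suc d)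
  let ?N = "nodes l (Suc d)"
  have into: "f x \<in> initial_closure C" if "x \<in> ?N" for x
    using Suc.prems that by (auto simp: meet_embedding_def)
  have sp: "strict_prefix x y \<longleftrightarrow> strict_prefix (f x) (f y)"
    if "x \<in> ?N" "y \<in> ?N" for x y
    using Suc.prems that by (auto simp: meet_embedding_def)
  have lcp: "f (longest_common_prefix x y) = longest_common_prefix (f x) (f y)"
    if "x \<in> ?N" "y \<in> ?N" for x y
    using Suc.prems that by (auto simp: meet_embedding_def)
  have inj: "inj_on f ?N" using Suc.prems by (auto simp: meet_embedding_def)
  define b where "b = f []"
  have nil: "[] \<in> ?N" by (simp add: nodes_def)
  have sing: "[i] \<in> ?N" if "i < l" for i using that by (simp add: nodes_def)
  have "\<exists>k r. f [i] = b @ k # r" if "i < l" for i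
  proof -
    have "strict_prefix b (f [i])" using sp[OF nil sing[OF that]] by (simp add: b_def)
    then show ?thesis by (auto elim: strict_prefixE')
  qed
  then obtain k r where kr: "\<And>i. i < l \<Longrightarrow> f [i] = b @ k i # r i" by metis
  \<comment> \<open>Two children of the root meet in the root, so their images meet in
    \<open>b\<close>; a shared direction \<open>k i\<close> would make that meet longer.\<close>
  have "inj_on k {..<l}"
  proof (rule inj_onI, rule ccontr)
    fix i j assume ij: "i \<in> {..<l}" "j \<in> {..<l}" "k i = k j" "i \<noteq> j"
    then have "longest_common_prefix (f [i]) (f [j]) = b"
      using lcp[of "[i]" "[j]"] sing by (simp add: b_def)
    moreover have "f [i] = b @ k i # r i" "f [j] = b @ k i # r j" using ij kr by auto
    ultimately show False by simp
  qed
  then have "card (k ` {..<l}) = l" by (simp add: card_image)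
  \<comment> \<open>Pigeonhole: \<open>l\<close> distinct directions cannot all lie among the
    \<open>l - 1\<close> that do not count for the norm.\<close>
  then have "\<not> k ` {..<l} \<subseteq> {..<l - 1}"
    using card_mono[of "{..<l - 1}" "k ` {..<l}"] \<open>1 \<le> l\<close> by auto
  then obtain i where i: "i < l" "l - 1 \<le> k i" by force
  \<comment> \<open>Branch \<open>i\<close> of the tree is mapped above \<open>p\<close>. Deleting
    \<open>p\<close> from its images embeds a tree of depth \<open>d\<close> in the subtree, while
    the last entry of \<open>p\<close> supplies the missing unit of norm.\<close>
  define p where "p = b @ [k i]"
  define g where "g x = drop (length p) (f (i # x))" for x
  have mem: "i # x \<in> ?N" if "x \<in> nodes l d" for x using that i by (simp add: nodes_def)
  have fg: "f (i # x) = p @ g x" if "x \<in> nodes l d" for x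
  proof -
    have "prefix (f [i]) (f (i # x))"
      using lcp[OF sing[OF i(1)] mem[OF that]] by (simp add: prefix_iff_lcp)
    then have "prefix p (f (i # x))" using kr[OF i(1)] by (auto simp: p_def prefix_def)
    then show ?thesis by (auto simp: g_def prefix_def)
  qed
  have "meet_embedding g (nodes l d) (initial_closure (subtree C p))"
  proof (rule meet_embeddingI)
    show "g x \<in> initial_closure (subtree C p)" if "x \<in> nodes l d" for x
      using into[OF mem[OF that]] fg[OF that] by (simp add: initial_closure_subtree)
    show "inj_on g (nodes l d)"
    proof (rule inj_onI)
      fix x y assume "x \<in> nodes l d" "y \<in> nodes l d" "g x = g y"
      then show "x = y" using inj_onD[OF inj, of "i # x" "i # y"] fg mem by simp
    qed
    show "g (longest_common_prefix x y) = longest_common_prefix (g x) (g y)"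
      if "x \<in> nodes l d" "y \<in> nodes l d" for x y
      using lcp[OF mem mem, of x y] fg[of x] fg[of y] fg[OF lcp_in_nodes, of x y] that by simp
  qed
  from Suc.IH[OF this] obtain y where "p @ y \<in> C" "d \<le> node_norm l y" by auto
  then show ?case using i by (intro bexI[of _ "p @ y"]) (auto simp: p_def node_norm_Cons)
qed

lemma norm_imp_meet_embedding:
  assumes "finite C" and "\<And>p. ordered_at l C p" and "\<exists>x\<in>C. d \<le> node_norm l x"
  shows "\<exists>f. meet_embedding f (nodes l d) (initial_closure C)"
  using assms
proof (induction d arbitrary: C)
  case 0
  then have "[] \<in> initial_closure C" by (auto simp: initial_closure_def)
  then have "meet_embedding (\<lambda>x. x) (nodes l 0) (initial_closure C)"
    by (intro meet_embeddingI) (auto simp: nodes_def)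
  then show ?case by blast
next
  case (Suc d)
  from Suc.prems(3) obtain x where "x \<in> C" "Suc d \<le> node_norm l x" by blast
  then obtain b k y where x: "b @ k # y \<in> C" "l - 1 \<le> k" "d \<le> node_norm l y"
    by (metis node_norm_split)
  have "\<exists>g. meet_embedding g (nodes l d) (initial_closure (subtree C (b @ [i])))" if "i < l" for i
  proof (rule Suc.IH)
    show "finite (subtree C (b @ [i]))" by (rule finite_subtree) fact
    show "ordered_at l (subtree C (b @ [i])) p" for p
      using Suc.prems(2)[of "b @ [i] @ p"] by (simp add: ordered_at_def)
    have "int d \<le> set_norm l (subtree C (b @ [k]))"
      using x finite_subtree[OF Suc.prems(1)] by (subst le_set_norm_iff) auto
    \<comment> \<open>From \<open>i < l\<close> and \<open>l - 1 \<le> k\<close> follows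
      \<open>i \<le> k\<close>, and child norms do not increase with the index.\<close>
    also have "\<dots> \<le> set_norm l (subtree C (b @ [i]))"
      by (rule lift_Suc_antimono_le[of "\<lambda>i. set_norm l (subtree C (b @ [i]))"])
        (use Suc.prems(2)[of b] that x(2) in \<open>auto simp: ordered_at_def\<close>)
    finally show "\<exists>x\<in>subtree C (b @ [i]). d \<le> node_norm l x"
      using le_set_norm_iff[OF finite_subtree[OF Suc.prems(1)]] by blast
  qed
  then obtain g where g: "\<And>i. i < l \<Longrightarrow>
      meet_embedding (g i) (nodes l d) (initial_closure (subtree C (b @ [i])))"
    by metis
  \<comment> \<open>The root goes to the branching node \<open>b\<close>, and branch
    \<open>i\<close> is placed above \<open>b @ [i]\<close> by the embedding
    \<open>g i\<close>.\<close>
  define f where "f x = b @ (case x of [] \<Rightarrow> [] | i # x' \<Rightarrow> i # g i x')" for x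
  have mem: "i < l \<and> x \<in> nodes l d" if "i # x \<in> nodes l (Suc d)" for i x
    using that by (auto simp: nodes_def)
  have "meet_embedding f (nodes l (Suc d)) (initial_closure C)"
  proof (rule meet_embeddingI)
    show "f x \<in> initial_closure C" if "x \<in> nodes l (Suc d)" for x
    proof (cases x)
      case Nil
      then show ?thesis using x by (auto simp: f_def intro: initial_closureI)
    next
      case (Cons i x')
      with that mem have "i < l" "x' \<in> nodes l d" by auto
      then have "g i x' \<in> initial_closure (subtree C (b @ [i]))"
        using g[of i] by (auto simp: meet_embedding_def)
      then show ?thesis using Cons by (simp add: f_def initial_closure_subtree)
    qed
    show "inj_on f (nodes l (Suc d))"
    proof (rule inj_onI)
      fix x y assume *: "x \<in> nodes l (Suc d)" "y \<in> nodes l (Suc d)" "f x = f y"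
      show "x = y"
      proof (cases x)
        case (Cons i x')
        with * obtain y' where y: "y = i # y'" "g i x' = g i y'"
          by (auto simp: f_def split: list.splits)
        have "inj_on (g i) (nodes l d)" using g[of i] mem * Cons by (auto simp: meet_embedding_def)
        then show ?thesis using y mem * Cons by (auto dest: inj_onD)
      qed (use * in \<open>auto simp: f_def split: list.splits\<close>)
    qed
    show "f (longest_common_prefix x y) = longest_common_prefix (f x) (f y)"
      if *: "x \<in> nodes l (Suc d)" "y \<in> nodes l (Suc d)" for x y
    proof (cases "\<exists>i x' y'. x = i # x' \<and> y = i # y'")
      case True
      then obtain i x' y' where xy: "x = i # x'" "y = i # y'" by blast
      then show ?thesis using g[of i] mem * by (auto simp: f_def meet_embedding_def)
    next
      case False
      \<comment> \<open>One sequence is empty or the first entries differ: the meet is the root, and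
        the images part exactly at \<open>b\<close>.\<close>
      then show ?thesis by (auto simp: f_def split: list.split)
    qed
  qed
  then show ?case by blast
qed

lemma MTD_eq_set_norm:
  assumes "1 \<le> l" and "finite C" and "\<And>p. ordered_at l C p"
  shows "MTD l C = set_norm l C"
proof (cases "C = {}")
  case False
  \<comment> \<open>The admissible depths are exactly the numbers up to the maximal norm, which is
    therefore the greatest.\<close>
  have "(\<exists>f. meet_embedding f (nodes l d) (initial_closure C)) \<longleftrightarrow> d \<le> Max (node_norm l ` C)" for d
    using meet_embedding_imp_norm[of _ l d C] norm_imp_meet_embedding[of C l d] assms False
    by (auto simp: Max_ge_iff)
  moreover have "(GREATEST d. d \<le> Max (node_norm l ` C)) = Max (node_norm l ` C)"
    by (rule Greatest_equality) auto
  ultimately show ?thesis using False by (simp add: MTD_def set_norm_def)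
qed (simp add: MTD_def)

subsection \<open>Swaps\<close>

lemma swap_Nil [simp]: "swap a k [] = []"
  by (simp add: swap_def)

text \<open>With \<open>swap_Cons\<close> this gives a recursive description of swaps along the
  address \<open>a\<close>, on which the inductions below rest.\<close>

lemma swap_at_root [simp]:
  "swap [] k (c # x) = (if c = k then Suc k else if c = Suc k then k else c) # x"
  by (auto simp: swap_def)

lemma swap_Cons [simp]: "swap (c # a) k (d # x) = d # (if c = d then swap a k x else x)"
  by (auto simp: swap_def)

lemma length_swap [simp]: "length (swap a k x) = length x"
proof (induction a arbitrary: x)
  case Nil
  show ?case by (cases x) auto
next
  case (Cons c a)
  then show ?case by (cases x) auto
qed

lemma swap_swap [simp]: "swap a k (swap a k x) = x"
proof (induction a arbitrary: x)
  case Nil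
  show ?case by (cases x) auto
next
  case (Cons c a)
  then show ?case by (cases x) auto
qed

lemma set_swap_subset: "set x \<subseteq> {..<m} \<Longrightarrow> Suc k < m \<Longrightarrow> set (swap a k x) \<subseteq> {..<m}"
proof (induction a arbitrary: x)
  case Nil
  then show ?case by (cases x) auto
next
  case (Cons c a)
  then show ?case by (cases x) auto
qed

text \<open>A swap permutes the entry right after \<open>a\<close> and leaves all else alone, so two
  sequences part at the same position before and after it.\<close>

lemma swap_lcp:
  "swap a k (longest_common_prefix x y) = longest_common_prefix (swap a k x) (swap a k y)"
proof (induction a arbitrary: x y)
  case Nil
  show ?case by (cases x; cases y) auto
next
  case (Cons c a)
  then show ?case by (cases x; cases y) auto
qed

lemma swap_append: "length a < length p \<Longrightarrow> swap a k (p @ x) = swap a k p @ x"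
proof (induction a arbitrary: p)
  case Nil
  then show ?case by (cases p) auto
next
  case (Cons c a)
  then show ?case by (cases p) auto
qed

lemma swap_child:
  "swap a k (a @ [j]) = a @ [if j = k then Suc k else if j = Suc k then k else j]"
  by (induction a) auto

lemma swap_not_above: "\<not> prefix a x \<Longrightarrow> swap a k x = x"
  by (auto simp: swap_def prefix_def)

lemma mem_swap_image: "x \<in> swap a k ` C \<longleftrightarrow> swap a k x \<in> C"
proof
  show "swap a k x \<in> C" if "x \<in> swap a k ` C" using that by auto
  show "x \<in> swap a k ` C" if "swap a k x \<in> C" using that by (intro image_eqI) auto
qed

text \<open>The swapped entry, if any, already lies inside \<open>p\<close>; what hangs above
  \<open>p\<close> is moved as a whole and unchanged.\<close>

lemma subtree_swap_image:
  "length a < length p \<Longrightarrow> subtree (swap a k ` C) p = subtree C (swap a k p)"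
  by (auto simp: mem_swap_image swap_append)

lemma swap_image_leaves:
  assumes "C \<subseteq> leaves m n" and "Suc k < m"
  shows "swap a k ` C \<subseteq> leaves m n"
proof (rule image_subsetI)
  fix x assume "x \<in> C"
  with assms(1) have "x \<in> leaves m n" by blast
  then show "swap a k x \<in> leaves m n"
    using set_swap_subset[OF _ assms(2)] by (simp add: leaves_def)
qed

lemma meet_embedding_swap:
  assumes "meet_embedding f (nodes m n) (initial_closure C)"
  shows "meet_embedding (swap a k \<circ> f) (nodes m n) (initial_closure (swap a k ` C))"
proof (rule meet_embeddingI)
  have mono: "prefix x y \<Longrightarrow> prefix (swap a k x) (swap a k y)" for x y
    using swap_lcp[of a k x y] by (simp add: prefix_iff_lcp)
  show "(swap a k \<circ> f) x \<in> initial_closure (swap a k ` C)" if "x \<in> nodes m n" for x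
  proof -
    have "f x \<in> initial_closure C" using assms that by (auto simp: meet_embedding_def)
    then show ?thesis using mono by (auto simp: initial_closure_def)
  qed
  have "inj_on f (nodes m n)" using assms by (simp add: meet_embedding_def)
  then show "inj_on (swap a k \<circ> f) (nodes m n)"
    by (rule comp_inj_on) (rule inj_on_inverseI, rule swap_swap)
  show "(swap a k \<circ> f) (longest_common_prefix x y)
      = longest_common_prefix ((swap a k \<circ> f) x) ((swap a k \<circ> f) y)"
    if "x \<in> nodes m n" "y \<in> nodes m n" for x y
    using assms that by (simp add: meet_embedding_def swap_lcp)
qed

text \<open>Composing with a swap transports embeddings. As the swap is an involution, this one
  direction gives the equivalence.\<close>

lemma MTD_swap: "MTD l (swap a k ` C) = MTD l C"
proof -
  define E where "E C d \<longleftrightarrow> (\<exists>f. meet_embedding f (nodes l d) (initial_closure C))" for C d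
  have mono: "E (swap a k ` C) d" if "E C d" for C d
  proof -
    from that obtain f where "meet_embedding f (nodes l d) (initial_closure C)"
      unfolding E_def by blast
    then show ?thesis
      unfolding E_def by (intro exI[of _ "swap a k \<circ> f"] meet_embedding_swap)
  qed
  have "swap a k ` swap a k ` C = C" by (simp add: image_image)
  then have "E (swap a k ` C) d \<longleftrightarrow> E C d" for d
    using mono[of C d] mono[of "swap a k ` C" d] by auto
  then show ?thesis by (simp add: MTD_def flip: E_def)
qed

subsection \<open>Bubble sort\<close>

text \<open>The effect of one comparison on the sequence of child norms: large values move left,
  small ones sink to the right.\<close>

definition bubble_step :: "nat \<Rightarrow> (nat \<Rightarrow> int) \<Rightarrow> nat \<Rightarrow> int" where
  "bubble_step k v = v(k := max (v k) (v (Suc k)), Suc k := min (v k) (v (Suc k)))"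

definition bubble_pass :: "nat \<Rightarrow> nat \<Rightarrow> (nat \<Rightarrow> int) \<Rightarrow> nat \<Rightarrow> int" where
  "bubble_pass m j v = fold bubble_step [0..<m - j - 1] v"

text \<open>Before pass \<open>j\<close> the last \<open>j\<close> positions are settled. The pass
  touches only positions up to \<open>m - j - 1\<close> and carries a least value among them to that
  last one, so the settled tail grows by one.\<close>

lemma bubble_pass_tail:
  assumes "\<And>k i. m - j \<le> k \<Longrightarrow> k < m \<Longrightarrow> i < k \<Longrightarrow> v k \<le> v i" and "j < m"
    and "m - Suc j \<le> k" "k < m" "i < k"
  shows "bubble_pass m j v k \<le> bubble_pass m j v i"
proof -
  \<comment> \<open>Invariant after \<open>t\<close> comparisons: the old tail is still below
    everything to its left, and position \<open>t\<close> holds a least value among positions 0 to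
    \<open>t\<close>.\<close>
  have "(\<forall>k i. m - j \<le> k \<longrightarrow> k < m \<longrightarrow> i < k \<longrightarrow>
        fold bubble_step [0..<t] v k \<le> fold bubble_step [0..<t] v i) \<and>
      (\<forall>i<t. fold bubble_step [0..<t] v t \<le> fold bubble_step [0..<t] v i)"
    if "t \<le> m - j - 1" for t
    using that
  proof (induction t)
    case 0
    then show ?case using assms(1) by auto
  next
    case (Suc t)
    define w where "w = fold bubble_step [0..<t] v"
    have tail: "w k \<le> w i" if "m - j \<le> k" "k < m" "i < k" for k i
      using Suc that by (simp add: w_def)
    have least: "w t \<le> w i" if "i < t" for i
      using Suc that by (simp add: w_def)
    have "bubble_step t w k \<le> bubble_step t w i" if "m - j \<le> k" "k < m" "i < k" for k i
      using tail[of k i] tail[of k t] tail[of k "Suc t"] that Suc.prems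
      by (auto simp: bubble_step_def)
    moreover have "bubble_step t w (Suc t) \<le> bubble_step t w i" if "i < Suc t" for i
      using least[of i] that by (cases "i = t") (auto simp: bubble_step_def)
    ultimately show ?case by (simp add: w_def)
  qed
  from this[of "m - j - 1"] show ?thesis
    using assms(2-) unfolding bubble_pass_def
    by (cases "k = m - j - 1") auto
qed

lemma bubble_sort:
  assumes "i < k" "k < m"
  shows "fold (bubble_pass m) [0..<m - 1] v k \<le> fold (bubble_pass m) [0..<m - 1] v i"
proof -
  have "\<forall>k i. m - j \<le> k \<longrightarrow> k < m \<longrightarrow> i < k \<longrightarrow>
      fold (bubble_pass m) [0..<j] v k \<le> fold (bubble_pass m) [0..<j] v i" if "j < m" for j
    using that
  proof (induction j)
    case (Suc j)
    then show ?case
      using bubble_pass_tail[of m j "fold (bubble_pass m) [0..<j] v"] by simp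
  qed simp
  \<comment> \<open>After \<open>m - 1\<close> passes all positions from 1 on are settled, and
    nothing lies to the left of position 0.\<close>
  from this[of "m - 1"] show ?thesis using assms by simp
qed

section \<open>Child norms under the sorting loops\<close>

definition child_norms :: "nat \<Rightarrow> node \<Rightarrow> node set \<Rightarrow> nat \<Rightarrow> int" where
  "child_norms l a C k = set_norm l (subtree C (a @ [k]))"

lemma child_norms_swap:
  "child_norms l a (swap a k ` C) = (child_norms l a C)
     (k := child_norms l a C (Suc k), Suc k := child_norms l a C k)"
  by (auto simp: child_norms_def subtree_swap_image swap_child)

text \<open>Subtrees that are both empty may be compared wrongly by \<^const>\<open>compare_step\<close>, because
  their relative norm is not \<open>- 1\<close>; interchanging them has no effect.\<close>

lemma child_norms_compare_step:
  assumes "finite C"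
  shows "child_norms l a (compare_step l a k C) = bubble_step k (child_norms l a C)"
proof -
  let ?v = "child_norms l a C"
  let ?r = "\<lambda>j. set_norm l (restrict_above C (a @ [j])) - int (node_norm l (a @ [j]))"
  have step: "compare_step l a k C = (if ?r (Suc k) \<le> ?r k then C else swap a k ` C)"
    by (simp only: compare_step_def)
  have rel_empty: "?r j < 0" if "subtree C (a @ [j]) = {}" for j
    using set_norm_restrict_above[OF assms, of l "a @ [j]"] that by simp
  have rel_nonempty: "?r j = ?v j" "0 \<le> ?v j" if "subtree C (a @ [j]) \<noteq> {}" for j
    using set_norm_restrict_above[OF assms, of l "a @ [j]"] set_norm_nonneg that
    by (simp_all add: child_norms_def)
  have *: "compare_step l a k C \<in> {C, swap a k ` C}" by (simp add: compare_step_def)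
  \<comment> \<open>In a tie either outcome of the test is fine, since interchanging equal values
    changes nothing; only strict inequalities must be decided correctly.\<close>
  consider "?v k = ?v (Suc k)"
    | "?v (Suc k) < ?v k" "compare_step l a k C = C"
    | "?v k < ?v (Suc k)" "compare_step l a k C = swap a k ` C"
  proof (cases "?v k" "?v (Suc k)" rule: linorder_cases)
    case less
    \<comment> \<open>The strictly larger value exceeds -1, so its subtree is nonempty and enters
      the test with its true, nonnegative norm; an empty sibling enters with a negative
      number.\<close>
    then have "subtree C (a @ [Suc k]) \<noteq> {}"
      using set_norm_ge[of l "subtree C (a @ [k])"] by (auto simp: child_norms_def)
    then have "?r k < ?r (Suc k)"
      using less rel_nonempty[of "Suc k"] rel_nonempty[of k] rel_empty[of k] by linarith
    then have "compare_step l a k C = swap a k ` C" using step by (simp only: linorder_not_le[symmetric] if_False)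
    then show ?thesis using less that by blast
  next
    case greater
    then have "subtree C (a @ [k]) \<noteq> {}"
      using set_norm_ge[of l "subtree C (a @ [Suc k])"] by (auto simp: child_norms_def)
    then have "?r (Suc k) \<le> ?r k"
      using greater rel_nonempty[of k] rel_nonempty[of "Suc k"] rel_empty[of "Suc k"] by linarith
    then have "compare_step l a k C = C" by (simp only: step if_True)
    then show ?thesis using greater that by blast
  qed (use that in blast)
  then show ?thesis
    using * by cases (auto simp: bubble_step_def child_norms_swap)
qed

lemma finite_compare_step: "finite C \<Longrightarrow> finite (compare_step l a k C)"
  by (simp add: compare_step_def)

lemma child_norms_sort_pass:
  assumes "finite C"
  shows "finite (sort_pass l m a j C) \<and>
    child_norms l a (sort_pass l m a j C) = bubble_pass m j (child_norms l a C)"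
proof -
  have "finite (fold (compare_step l a) ks C) \<and>
      child_norms l a (fold (compare_step l a) ks C) = fold bubble_step ks (child_norms l a C)" for ks
    using assms
    by (induction ks arbitrary: C) (simp_all add: child_norms_compare_step finite_compare_step)
  then show ?thesis by (simp add: sort_pass_def bubble_pass_def)
qed

lemma child_norms_sort_at:
  assumes "finite C"
  shows "child_norms l a (sort_at l m a C) = fold (bubble_pass m) [0..<m - 1] (child_norms l a C)"
proof -
  have "child_norms l a (fold (sort_pass l m a) js C) = fold (bubble_pass m) js (child_norms l a C)"
    for js
    using assms by (induction js arbitrary: C) (simp_all add: child_norms_sort_pass)
  then show ?thesis by (simp add: sort_at_def)
qed

subsection \<open>Normalization\<close>

lemma fold_invariant_set:
  assumes "P s" and "\<And>x s. x \<in> set xs \<Longrightarrow> P s \<Longrightarrow> P (f x s)"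
  shows "P (fold f xs s)"
  using assms by (induction xs arbitrary: s) auto

text \<open>Sorting at \<open>a\<close> only performs swaps at \<open>a\<close> with
  \<open>Suc k < m\<close>. Leaves, dimension and order at other nodes are all handled through this
  principle.\<close>

lemma sort_at_invariant:
  assumes "P C" and "\<And>k C. Suc k < m \<Longrightarrow> P C \<Longrightarrow> P (swap a k ` C)"
  shows "P (sort_at l m a C)"
proof -
  have step: "P (compare_step l a k C)" if "P C" "Suc k < m" for k C
    using assms(2) that by (simp add: compare_step_def)
  have "P (sort_pass l m a j C)" if "P C" for j C
    unfolding sort_pass_def by (rule fold_invariant_set[where P = P]) (use step that in auto)
  then show ?thesis
    unfolding sort_at_def using assms(1) by (intro fold_invariant_set[where P = P])
qed

lemma sort_at_leaves: "C \<subseteq> leaves m n \<Longrightarrow> sort_at l m a C \<subseteq> leaves m n"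
  by (rule sort_at_invariant[where P = "\<lambda>C. C \<subseteq> leaves m n"]) (simp_all add: swap_image_leaves)

lemma MTD_sort_at: "MTD l (sort_at l m a C) = MTD l C"
  by (rule sort_at_invariant[where P = "\<lambda>D. MTD l D = MTD l C"]) (simp_all add: MTD_swap)

lemma ordered_at_sort_at:
  assumes "C \<subseteq> leaves m n"
  shows "ordered_at l (sort_at l m a C) a"
  unfolding ordered_at_def
proof
  fix k
  let ?D = "sort_at l m a C"
  show "set_norm l (subtree ?D (a @ [Suc k])) \<le> set_norm l (subtree ?D (a @ [k]))"
  proof (cases "Suc k < m")
    case True
    have "finite C" using assms finite_leaves finite_subset by blast
    then show ?thesis
      using bubble_sort[of k "Suc k" m "child_norms l a C"] True child_norms_sort_at[of C l a m]
      by (metis child_norms_def lessI)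
  next
    case False
    \<comment> \<open>The child \<open>Suc k\<close> lies outside the alphabet, so its subtree is
      empty and its norm -1 is below any other.\<close>
    then show ?thesis
      using subtree_empty_of_ge[OF sort_at_leaves[OF assms], of "Suc k" l a a] set_norm_ge by simp
  qed
qed

text \<open>A swap permutes the nodes longer than \<open>a\<close>, moving their subtrees along;
  hence the order is assumed at all of them together and not at \<open>p\<close> alone.\<close>

lemma ordered_at_sort_at_longer:
  assumes "\<And>p. length a < length p \<Longrightarrow> ordered_at l C p" and "length a < length p"
  shows "ordered_at l (sort_at l m a C) p"
proof -
  have "\<forall>p. length a < length p \<longrightarrow> ordered_at l (sort_at l m a C) p"
  proof (rule sort_at_invariant)
    fix k C
    assume ord: "\<forall>p. length a < length p \<longrightarrow> ordered_at l C p"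
    show "\<forall>p. length a < length p \<longrightarrow> ordered_at l (swap a k ` C) p"
      using ord by (auto simp: ordered_at_def subtree_swap_image swap_append)
  qed (use assms in blast)
  then show ?thesis using assms by blast
qed

lemma ordered_at_sort_at_incomparable:
  assumes "ordered_at l C p" and "length p = length a" and "p \<noteq> a"
  shows "ordered_at l (sort_at l m a C) p"
proof (rule sort_at_invariant[where P = "\<lambda>C. ordered_at l C p"])
  fix k C
  assume ord: "ordered_at l C p"
  \<comment> \<open>A prefix of \<open>p @ [j]\<close> as long as \<open>p\<close> is
    \<open>p\<close> itself, so swaps at \<open>a\<close> fix the children of
    \<open>p\<close>.\<close>
  have "\<not> prefix a (p @ [j])" for j
    using assms(2,3) by (auto simp: prefix_def append_eq_append_conv)
  then show "ordered_at l (swap a k ` C) p"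
    using ord assms(2) by (simp add: ordered_at_def subtree_swap_image swap_not_above)
qed fact

text \<open>Loop invariant: after \<open>i\<close> rounds the set consists of leaves, has the
  dimension of \<open>B\<close>, and is ordered at the first \<open>i\<close> nodes of the
  enumeration.\<close>

lemma normalization_correct:
  assumes "longest_first_enumeration m n a" and "B \<subseteq> leaves m n"
  shows "normalization l m n a B \<subseteq> leaves m n"
    and "MTD l (normalization l m n a B) = MTD l B"
    and "ordered_at l (normalization l m n a B) p"
proof -
  let ?N = "num_inner_nodes m n"
  let ?C = "\<lambda>i. fold (\<lambda>i. sort_at l m (a i)) [0..<i] B"
  have bij: "bij_betw a {..<?N} (inner_nodes m n)"
    and order: "\<And>i j. i < ?N \<Longrightarrow> j < ?N \<Longrightarrow> length (a j) < length (a i) \<Longrightarrow> i < j"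
    using assms(1) by (auto simp: longest_first_enumeration_def)
  \<comment> \<open>Outside the inner nodes all child subtrees are empty, so order holds trivially;
    this extends it to every \<open>p\<close>.\<close>
  have not_inner: "ordered_at l C p" if "C \<subseteq> leaves m n" "p \<notin> inner_nodes m n" for C p
    using subtree_empty_of_not_inner[OF that] by (simp add: ordered_at_def)
  have main: "?C i \<subseteq> leaves m n \<and> MTD l (?C i) = MTD l B \<and> (\<forall>j<i. ordered_at l (?C i) (a j))"
    if "i \<le> ?N" for i
    using that
  proof (induction i)
    case 0
    then show ?case using assms by simp
  next
    case (Suc i)
    define C where "C = ?C i"
    have C: "C \<subseteq> leaves m n" "MTD l C = MTD l B" "\<And>j. j < i \<Longrightarrow> ordered_at l C (a j)"
      using Suc by (auto simp: C_def)
    \<comment> \<open>An inner node longer than \<open>a i\<close> was enumerated, and so sorted,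
      before it.\<close>
    have longer: "ordered_at l C p" if len: "length (a i) < length p" for p
    proof (cases "p \<in> inner_nodes m n")
      case True
      then obtain j where j: "j < ?N" "p = a j"
        using bij by (auto simp: bij_betw_def)
      then have "j < i" using order[of j i] len Suc.prems by simp
      then show ?thesis using C j by simp
    qed (use not_inner C in blast)
    have "ordered_at l (sort_at l m (a i) C) (a j)" if "j < Suc i" for j
    proof (cases "j = i")
      case True
      then show ?thesis using ordered_at_sort_at C by blast
    next
      case False
      then have "j < i" using that by simp
      then have "a j \<noteq> a i"
        using bij Suc.prems by (auto simp: bij_betw_def dest: inj_onD)
      \<comment> \<open>An earlier node is never shorter: it is either longer than
        \<open>a i\<close>, or of equal length and incomparable to it.\<close>
      moreover have "length (a i) \<le> length (a j)"
        using order[of i j] \<open>j < i\<close> Suc.prems by linarith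
      ultimately show ?thesis
        using ordered_at_sort_at_longer[of "a i" l C "a j" m, OF longer]
          ordered_at_sort_at_incomparable[of l C "a j" "a i" m] C(3)[OF \<open>j < i\<close>]
        by (cases "length (a j) = length (a i)") auto
    qed
    then show ?case
      using sort_at_leaves[OF C(1)] MTD_sort_at[of l m "a i" C] C(2) by (simp add: C_def)
  qed
  show leaves: "normalization l m n a B \<subseteq> leaves m n"
    and "MTD l (normalization l m n a B) = MTD l B"
    using main[of ?N] by (auto simp: normalization_def)
  show "ordered_at l (normalization l m n a B) p"
  proof (cases "p \<in> inner_nodes m n")
    case True
    then obtain j where "j < ?N" "p = a j" using bij by (auto simp: bij_betw_def)
    then show ?thesis using main[of ?N] by (auto simp: normalization_def)
  qed (use not_inner leaves in blast)
qed

theorem theorem2p8: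
  fixes m l n :: nat and B :: "nat list set" and a :: "nat \<Rightarrow> nat list"
  assumes "l \<ge> 2" and "m \<ge> l"
    and "B \<subseteq> leaves m n"
    and "longest_first_enumeration m n a"
  shows "MTD l B = set_norm l (normalization l m n a B)"
proof -
  note norm = normalization_correct[OF assms(4,3), of l]
  have "finite (normalization l m n a B)"
    using norm(1) finite_leaves finite_subset by blast
  then show ?thesis
    using MTD_eq_set_norm[of l "normalization l m n a B"] norm(2,3) assms(1) by simp
qed

end
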